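(* Let $\mathcal{A}$ be an independence algebra with universe $A$ and let $\mathcal{B}$ be a non-empty subalgebra of $\mathcal{A}$ with universe $B$. Assume $\mathcal{B}\neq\mathcal{A}$ and that either $\dim B\geq 2$, or $\langle\emptyset\rangle\neq\emptyset$ and $\dim B=1$. Let $T(\mathcal{A},\mathcal{B})$ be the semigroup of all endomorphisms of $\mathcal{A}$ whose image is contained in $B$, and let $Q=\{\alpha\in T(\mathcal{A},\mathcal{B}): A\alpha\subseteq B\alpha\}$. If $\alpha\in T(\mathcal{A},\mathcal{B})$ and $\beta\in Q$, then $\alpha=\lambda\beta$ for some $\lambda\in T(\mathcal{A},\mathcal{B})$ if and only if $\mathrm{im}\,\alpha\subseteq\mathrm{im}\,\beta$. Consequently, for $\alpha,\beta\in T(\mathcal{A},\mathcal{B})$, $\alpha\,\mathcal{L}\,\beta$ in $T(\mathcal{A},\mathcal{B})$ if and only if $\alpha=\beta$ or ($\mathrm{im}\,\alpha=\mathrm{im}\,\beta$ and $\alpha,\beta\in Q$).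
   Context: An algebra $\mathcal{A}=\langle A;F\rangle$ has a non-empty universe $A$ and a set $F$ of finitary operations. For $X\subseteq A$, $\langle X\rangle$ is the set of all $t(a_1,\dots,a_n)$ with $t$ a term operation and $a_i\in X$ (the subalgebra generated by $X$); $\langle\emptyset\rangle$ is the set of constants, i.e. values of nullary term operations (possibly empty). $X$ is independent if $x\notin\langle X\setminus\{x\}\rangle$ for all $x\in X$; a basis of a subalgebra is an independent generating set. Exchange property (EP): for all $X\subseteq A$ and $a,b\in A$, if $b\in\langle X\cup\{a\}\rangle$ and $b\notin\langle X\rangle$ then $a\in\langle X\cup\{b\}\rangle$. Under (EP) every subalgebra has a basis, all its bases have the same cardinality (its dimension, $\dim$), and independent sets extend to bases. Free basis property (F): every map from a basis of $\mathcal{A}$ to $A$ extends to an endomorphism of $\mathcal{A}$. An independence algebra is an algebra satisfying (EP) and (F). Dimensions may be finite or infinite. Maps are written on the right and composed left to right. $\mathrm{im}\,\alpha=A\alpha$. $\mathcal{L}$ is Green's relation: $a\,\mathcal{L}\,b$ in a semigroup $S$ iff $S^1a=S^1b$. *)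

theory Defs
  imports Main "HOL-Library.FuncSet"
begin

unbundle cardinal_syntax

text \<open>A finitary operation is a pair of an arity \<open>k\<close> and a function on lists, of which only the values
  on lists of length \<open>k\<close> over the universe matter.\<close>

type_synonym 'a operation = "nat \<times> ('a list \<Rightarrow> 'a)"

definition closed_under :: "'a operation set \<Rightarrow> 'a set \<Rightarrow> bool" where
  "closed_under F C \<longleftrightarrow> (\<forall>(k, f)\<in>F. \<forall>xs. length xs = k \<and> set xs \<subseteq> C \<longrightarrow> f xs \<in> C)"

text \<open>\<open>term_op F n t\<close>: \<open>t\<close> is an \<open>n\<close>-ary term operation. There are no nullary projections, so nullary
  term operations exist only if \<open>F\<close> contains a nullary operation.\<close>

inductive term_op :: "'a operation set \<Rightarrow> nat \<Rightarrow> ('a list \<Rightarrow> 'a) \<Rightarrow> bool" for F n where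
  proj: "i < n \<Longrightarrow> term_op F n (\<lambda>xs. xs ! i)"
| comp: "(k, f) \<in> F \<Longrightarrow> length ts = k \<Longrightarrow> (\<And>t. t \<in> set ts \<Longrightarrow> term_op F n t)
    \<Longrightarrow> term_op F n (\<lambda>xs. f (map (\<lambda>t. t xs) ts))"

definition gen :: "'a operation set \<Rightarrow> 'a set \<Rightarrow> 'a set" where
  "gen F X = {t xs | t xs. term_op F (length xs) t \<and> set xs \<subseteq> X}"

definition subalgebra :: "'a set \<Rightarrow> 'a operation set \<Rightarrow> 'a set \<Rightarrow> bool" where
  "subalgebra A F C \<longleftrightarrow> C \<subseteq> A \<and> closed_under F C"

definition indep :: "'a operation set \<Rightarrow> 'a set \<Rightarrow> bool" where
  "indep F X \<longleftrightarrow> (\<forall>x\<in>X. x \<notin> gen F (X - {x}))"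

text \<open>\<open>X \<subseteq> C\<close> follows from \<open>gen F X = C\<close>, since projections are term operations.\<close>

definition basis_of :: "'a operation set \<Rightarrow> 'a set \<Rightarrow> 'a set \<Rightarrow> bool" where
  "basis_of F C X \<longleftrightarrow> indep F X \<and> gen F X = C"

text \<open>The dimension is a cardinal, to be compared with \<open>\<le>o\<close> and \<open>=o\<close>; it is meaningful for subalgebras
  of algebras with the exchange property, where bases exist and are equipotent.\<close>

definition dimension :: "'a operation set \<Rightarrow> 'a set \<Rightarrow> 'a rel" where
  "dimension F C = |SOME X. basis_of F C X|"

text \<open>Maps \<open>A \<rightarrow> A\<close> are represented by extensional functions, so that HOL equality is equality on \<open>A\<close>.\<close>

definition endos :: "'a set \<Rightarrow> 'a operation set \<Rightarrow> ('a \<Rightarrow> 'a) set" where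
  "endos A F = {\<phi> \<in> A \<rightarrow>\<^sub>E A.
     \<forall>(k, f)\<in>F. \<forall>xs. length xs = k \<and> set xs \<subseteq> A \<longrightarrow> \<phi> (f xs) = f (map \<phi> xs)}"

locale univ_algebra =
  fixes A :: "'a set" and F :: "'a operation set"
  assumes nonempty: "A \<noteq> {}"
    and closed: "closed_under F A"

locale independence_algebra = univ_algebra +
  assumes exchange: "\<lbrakk>X \<subseteq> A; a \<in> A; b \<in> A; b \<in> gen F (insert a X); b \<notin> gen F X\<rbrakk>
      \<Longrightarrow> a \<in> gen F (insert b X)"
    and free_basis: "\<lbrakk>basis_of F A X; g \<in> X \<rightarrow> A\<rbrakk> \<Longrightarrow> \<exists>\<phi>\<in>endos A F. \<forall>x\<in>X. \<phi> x = g x"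

text \<open>Maps compose from left to right: \<open>rcomp A \<alpha> \<beta>\<close> applies \<open>\<alpha>\<close> first.\<close>

definition rcomp :: "'a set \<Rightarrow> ('a \<Rightarrow> 'a) \<Rightarrow> ('a \<Rightarrow> 'a) \<Rightarrow> 'a \<Rightarrow> 'a" where
  "rcomp A \<alpha> \<beta> = compose A \<beta> \<alpha>"

definition T :: "'a set \<Rightarrow> 'a operation set \<Rightarrow> 'a set \<Rightarrow> ('a \<Rightarrow> 'a) set" where
  "T A F B = {\<alpha> \<in> endos A F. \<alpha> ` A \<subseteq> B}"

definition Q :: "'a set \<Rightarrow> 'a operation set \<Rightarrow> 'a set \<Rightarrow> ('a \<Rightarrow> 'a) set" where
  "Q A F B = {\<alpha> \<in> T A F B. \<alpha> ` A \<subseteq> \<alpha> ` B}"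

text \<open>\<open>S\<^sup>1a = {a} \<union> Sa\<close>, whether or not the semigroup \<open>S\<close> already has an identity.\<close>

definition principal_left_ideal :: "'s set \<Rightarrow> ('s \<Rightarrow> 's \<Rightarrow> 's) \<Rightarrow> 's \<Rightarrow> 's set" where
  "principal_left_ideal S mul a = insert a ((\<lambda>s. mul s a) ` S)"

definition green_L :: "'s set \<Rightarrow> ('s \<Rightarrow> 's \<Rightarrow> 's) \<Rightarrow> 's \<Rightarrow> 's \<Rightarrow> bool" where
  "green_L S mul a b \<longleftrightarrow> a \<in> S \<and> b \<in> S
     \<and> principal_left_ideal S mul a = principal_left_ideal S mul b"

end

theory Submission
  imports Defs
begin

text \<open>Given \<open>im \<alpha> \<subseteq> im \<beta>\<close> with \<open>\<beta> \<in> Q\<close>, every value of \<open>\<alpha>\<close> on a basis of \<open>A\<close> has a \<open>\<beta>\<close>-preimage in \<open>B\<close>;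
  mapping basis elements to such preimages extends to an endomorphism \<open>\<lambda>\<close> by the free basis property,
  its image lies in \<open>B\<close>, and \<open>\<alpha> = \<lambda>\<beta>\<close> since both sides agree on the basis. Conversely, if \<open>\<alpha> = \<lambda>\<beta>\<close> and
  \<open>\<beta> = \<mu>\<alpha>\<close>, then \<open>A\<alpha> = A\<lambda>\<beta> \<subseteq> B\<beta> = B\<mu>\<alpha> \<subseteq> B\<alpha>\<close>, so \<open>\<alpha> \<in> Q\<close>, and likewise for \<open>\<beta>\<close>.\<close>

section \<open>Term operations and generated subalgebras\<close>

lemma closed_underD:
  "\<lbrakk>closed_under F C; (k, f) \<in> F; length xs = k; set xs \<subseteq> C\<rbrakk> \<Longrightarrow> f xs \<in> C"
  unfolding closed_under_def by blast

lemma closed_underI: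
  "(\<And>f xs. \<lbrakk>(length xs, f) \<in> F; set xs \<subseteq> C\<rbrakk> \<Longrightarrow> f xs \<in> C) \<Longrightarrow> closed_under F C"
  unfolding closed_under_def by blast

lemma term_op_closed:
  assumes "term_op F n t" "closed_under F C" "length xs = n" "set xs \<subseteq> C"
  shows "t xs \<in> C"
  using assms(1)
proof induction
  case (proj i)
  then show ?case using assms by (metis nth_mem subsetD)
next
  case (comp k f ts)
  then show ?case using assms(2) by (intro closed_underD[OF assms(2) comp(1)]) auto
qed

lemma genI: "\<lbrakk>term_op F (length xs) t; set xs \<subseteq> X\<rbrakk> \<Longrightarrow> t xs \<in> gen F X"
  unfolding gen_def by blast

lemma gen_minimal: "\<lbrakk>closed_under F C; X \<subseteq> C\<rbrakk> \<Longrightarrow> gen F X \<subseteq> C"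
  unfolding gen_def using term_op_closed[of F] by blast

text \<open>A renaming \<open>r\<close> of variables passes through every composition down to the
  projections, where it is again a projection. With \<open>r\<close> the identity or a shift this
  adds dummy variables, which is its use below.\<close>

lemma term_op_reindex:
  assumes "term_op F n t" "\<And>i. i < n \<Longrightarrow> r i < m"
  shows "term_op F m (\<lambda>xs. t (map (\<lambda>i. xs ! r i) [0..<n]))"
  using assms(1)
proof induction
  case (proj i)
  then show ?case using term_op.proj[of "r i" m F] assms(2) by simp
next
  case (comp k f ts)
  let ?ts = "map (\<lambda>t xs. t (map (\<lambda>i. xs ! r i) [0..<n])) ts"
  have "term_op F m (\<lambda>xs. f (map (\<lambda>t. t xs) ?ts))"
    using comp by (intro term_op.comp[of k]) auto
  then show ?case by (simp add: comp_def)
qed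

lemma term_op_append_right:
  assumes "term_op F n t"
  obtains t' where "term_op F (n + m) t'" "\<And>xs ys. length xs = n \<Longrightarrow> t' (xs @ ys) = t xs"
proof
  show "term_op F (n + m) (\<lambda>xs. t (map (\<lambda>i. xs ! i) [0..<n]))"
    using assms by (rule term_op_reindex) simp
  fix xs ys :: "'a list" assume "length xs = n"
  then have "map (\<lambda>i. (xs @ ys) ! i) [0..<n] = xs"
    by (intro nth_equalityI) (auto simp: nth_append)
  then show "t (map (\<lambda>i. (xs @ ys) ! i) [0..<n]) = t xs" by simp
qed

lemma term_op_append_left:
  assumes "term_op F n t"
  obtains t' where "term_op F (m + n) t'"
    "\<And>xs ys. \<lbrakk>length xs = m; length ys = n\<rbrakk> \<Longrightarrow> t' (xs @ ys) = t ys"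
proof
  show "term_op F (m + n) (\<lambda>xs. t (map (\<lambda>i. xs ! (m + i)) [0..<n]))"
    using assms by (rule term_op_reindex) simp
  fix xs ys :: "'a list" assume "length xs = m" "length ys = n"
  then have "map (\<lambda>i. (xs @ ys) ! (m + i)) [0..<n] = ys"
    by (intro nth_equalityI) (auto simp: nth_append)
  then show "t (map (\<lambda>i. (xs @ ys) ! (m + i)) [0..<n]) = t ys" by simp
qed

text \<open>Each element of \<open>gen F X\<close> comes with its own argument list. Concatenating
  these lists and padding the term operations with dummy variables lets all of them be evaluated at
  one list, as composition in \<open>term_op\<close> requires.\<close>

lemma gen_common_arguments:
  assumes "set ys \<subseteq> gen F X"
  shows "\<exists>zs ts. set zs \<subseteq> X \<and> (\<forall>t\<in>set ts. term_op F (length zs) t) \<and> map (\<lambda>t. t zs) ts = ys"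
  using assms
proof (induction ys)
  case Nil
  show ?case by (intro exI[of _ "[]"]) auto
next
  case (Cons y ys)
  then obtain zs ts where IH: "set zs \<subseteq> X" "\<And>t. t \<in> set ts \<Longrightarrow> term_op F (length zs) t"
      "map (\<lambda>t. t zs) ts = ys"
    by (metis set_subset_Cons subset_trans)
  obtain t xs where t: "y = t xs" "term_op F (length xs) t" "set xs \<subseteq> X"
    using Cons.prems by (auto simp: gen_def)
  \<comment> \<open>On \<open>xs @ zs\<close> the new term ignores the tail \<open>zs\<close>, and
    the earlier terms ignore the prefix \<open>xs\<close>.\<close>
  obtain t' where t': "term_op F (length xs + length zs) t'" "t' (xs @ zs) = y"
    using term_op_append_right[OF t(2)] t(1) by metis
  have "\<exists>s'. term_op F (length xs + length zs) s' \<and> s' (xs @ zs) = s zs" if "s \<in> set ts" for s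
    using term_op_append_left[OF IH(2)[OF that]] by metis
  then obtain h where h: "\<And>s. s \<in> set ts \<Longrightarrow> term_op F (length xs + length zs) (h s)"
      "\<And>s. s \<in> set ts \<Longrightarrow> h s (xs @ zs) = s zs"
    by metis
  show ?case
    using t t' h IH by (intro exI[of _ "xs @ zs"] exI[of _ "t' # map h ts"]) auto
qed

lemma closed_under_gen: "closed_under F (gen F X)"
proof (rule closed_underI)
  fix f ys assume f: "(length ys, f) \<in> F" "set ys \<subseteq> gen F X"
  then obtain zs ts where z: "set zs \<subseteq> X" "\<And>t. t \<in> set ts \<Longrightarrow> term_op F (length zs) t"
      "map (\<lambda>t. t zs) ts = ys"
    using gen_common_arguments by metis
  have "term_op F (length zs) (\<lambda>xs. f (map (\<lambda>t. t xs) ts))"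
    by (rule term_op.comp[OF f(1)]) (use z in auto)
  from genI[OF this z(1)] show "f ys \<in> gen F X" by (simp add: z(3))
qed

lemma gen_superset: "X \<subseteq> gen F X"
proof
  fix x assume "x \<in> X"
  moreover have "term_op F (length [x]) (\<lambda>xs. xs ! 0)" by (rule term_op.proj) simp
  ultimately show "x \<in> gen F X"
    using genI[of F "[x]" "\<lambda>xs. xs ! 0" X] by simp
qed

lemma gen_mono: "X \<subseteq> Y \<Longrightarrow> gen F X \<subseteq> gen F Y"
  unfolding gen_def by blast

section \<open>Finitary dependence and the existence of a basis\<close>

lemma gen_finitary:
  assumes "y \<in> gen F X"
  obtains Y where "finite Y" "Y \<subseteq> X" "y \<in> gen F Y"
proof -
  obtain t xs where "y = t xs" "term_op F (length xs) t" "set xs \<subseteq> X"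
    using assms by (auto simp: gen_def)
  then show thesis by (intro that[of "set xs"]) (simp_all add: genI)
qed

text \<open>A dependence in the union involves only finitely many elements. These already lie in a
  single member of the nonempty chain, contradicting its independence.\<close>

lemma indep_Union_chain:
  assumes "subset.chain {X. X \<subseteq> A \<and> indep F X} \<C>" "\<C> \<noteq> {}"
  shows "indep F (\<Union>\<C>)"
  unfolding indep_def
proof (intro ballI notI)
  fix x assume x: "x \<in> \<Union>\<C>" and "x \<in> gen F (\<Union>\<C> - {x})"
  then obtain Y where Y: "finite Y" "Y \<subseteq> \<Union>\<C> - {x}" "x \<in> gen F Y"
    using gen_finitary by metis
  have "finite (insert x Y)" "insert x Y \<subseteq> \<Union>\<C>" using x Y by auto
  then obtain Z where Z: "Z \<in> \<C>" "insert x Y \<subseteq> Z"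
    using finite_subset_Union_chain[OF _ _ assms(2,1)] by blast
  then have "x \<in> gen F (Z - {x})"
    using Y gen_mono[of Y "Z - {x}" F] by blast
  moreover have "indep F Z" using assms(1) Z by (auto simp: subset.chain_def)
  ultimately show False using Z by (auto simp: indep_def)
qed

context independence_algebra
begin

text \<open>If some \<open>x\<close> in \<open>X\<close> became dependent after adding
  \<open>a\<close>, exchange over \<open>X - {x}\<close> would make \<open>a\<close> depend on
  \<open>X\<close>.\<close>

lemma indep_insert:
  assumes "X \<subseteq> A" "indep F X" "a \<in> A" "a \<notin> gen F X"
  shows "indep F (insert a X)"
  unfolding indep_def
proof (intro ballI notI)
  have aX: "a \<notin> X" using assms(4) gen_superset[of X F] by blast
  fix x assume x: "x \<in> insert a X" "x \<in> gen F (insert a X - {x})"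
  show False
  proof (cases "x = a")
    case True
    then show False using x(2) assms(4) aX by simp
  next
    case False
    then have "x \<in> X" "x \<in> gen F (insert a (X - {x}))"
      using x by (auto simp: insert_Diff_if)
    moreover have "x \<notin> gen F (X - {x})" using assms(2) \<open>x \<in> X\<close> by (auto simp: indep_def)
    ultimately have "a \<in> gen F (insert x (X - {x}))"
      using assms exchange[of "X - {x}" a x] by auto
    \<comment> \<open>Putting \<open>x\<close> back into \<open>X - {x}\<close> restores
      \<open>X\<close>.\<close>
    then show False using assms(4) \<open>x \<in> X\<close> by (simp add: insert_absorb)
  qed
qed

text \<open>Zorn's lemma gives a maximal independent subset of \<open>A\<close>; any element outside
  its span could be added by \<open>indep_insert\<close>, so it generates \<open>A\<close>.\<close>

lemma basis_exists: "\<exists>X. basis_of F A X"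
proof -
  let ?I = "{X. X \<subseteq> A \<and> indep F X}"
  have "\<exists>M\<in>?I. \<forall>X\<in>?I. M \<subseteq> X \<longrightarrow> X = M"
  proof (rule subset_Zorn_nonempty)
    show "?I \<noteq> {}" by (auto simp: indep_def)
    fix \<C> assume c: "\<C> \<noteq> {}" "subset.chain ?I \<C>"
    then show "\<Union>\<C> \<in> ?I"
      using indep_Union_chain[OF c(2,1)] by (auto simp: subset.chain_def)
  qed
  then obtain M where M: "M \<subseteq> A" "indep F M" and max: "\<And>X. \<lbrakk>X \<subseteq> A; indep F X; M \<subseteq> X\<rbrakk> \<Longrightarrow> X = M"
    by auto
  have "A \<subseteq> gen F M"
  proof
    fix a assume a: "a \<in> A"
    show "a \<in> gen F M"
    proof (rule ccontr)
      assume n: "a \<notin> gen F M"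
      then have "insert a M = M"
        using indep_insert[OF M a n] M(1) a max[of "insert a M"] by auto
      then show False using n gen_superset[of M F] by blast
    qed
  qed
  then have "basis_of F A M"
    using M gen_minimal[OF closed M(1)] by (auto simp: basis_of_def)
  then show ?thesis ..
qed

end

section \<open>Endomorphisms and their values on a generating set\<close>

lemma endos_hom:
  "\<lbrakk>\<phi> \<in> endos A F; (length xs, f) \<in> F; set xs \<subseteq> A\<rbrakk> \<Longrightarrow> \<phi> (f xs) = f (map \<phi> xs)"
  unfolding endos_def by blast

lemma endos_funcset: "\<phi> \<in> endos A F \<Longrightarrow> \<phi> \<in> A \<rightarrow>\<^sub>E A"
  unfolding endos_def by blast

text \<open>The equalizer of two endomorphisms is closed under the operations, so it is all of
  \<open>A\<close> once it contains a generating set.\<close>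

lemma endos_eqI:
  assumes \<phi>: "\<phi> \<in> endos A F" and \<psi>: "\<psi> \<in> endos A F" and A: "closed_under F A"
    and X: "gen F X = A" and eq: "\<And>x. x \<in> X \<Longrightarrow> \<phi> x = \<psi> x"
  shows "\<phi> = \<psi>"
proof -
  let ?E = "{a \<in> A. \<phi> a = \<psi> a}"
  have "closed_under F ?E"
  proof (rule closed_underI)
    fix f xs assume f: "(length xs, f) \<in> F" and xs: "set xs \<subseteq> ?E"
    then have "f xs \<in> A" by (intro closed_underD[OF A f]) auto
    moreover have "\<phi> (f xs) = \<psi> (f xs)"
    proof -
      have "map \<phi> xs = map \<psi> xs" "set xs \<subseteq> A" using xs by auto
      then show ?thesis using endos_hom[OF \<phi> f] endos_hom[OF \<psi> f] by metis
    qed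
    ultimately show "f xs \<in> ?E" by blast
  qed
  moreover have "X \<subseteq> ?E" using X eq gen_superset[of X F] by auto
  ultimately have "A \<subseteq> ?E" using gen_minimal[of F ?E X] X by simp
  \<comment> \<open>Both maps are \<open>undefined\<close> outside \<open>A\<close>, so agreement on
    \<open>A\<close> is equality in HOL.\<close>
  then show ?thesis
    using endos_funcset[OF \<phi>] endos_funcset[OF \<psi>] by (intro PiE_ext) auto
qed

text \<open>The preimage of a closed set under an endomorphism is closed, so it is enough that it
  contains the generators.\<close>

lemma endos_image_subset:
  assumes \<phi>: "\<phi> \<in> endos A F" and A: "closed_under F A" and B: "closed_under F B"
    and X: "gen F X = A" and im: "\<phi> ` X \<subseteq> B"
  shows "\<phi> ` A \<subseteq> B"
proof -
  let ?P = "{a \<in> A. \<phi> a \<in> B}"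
  have "closed_under F ?P"
  proof (rule closed_underI)
    fix f xs assume f: "(length xs, f) \<in> F" and xs: "set xs \<subseteq> ?P"
    then have A': "f xs \<in> A" by (intro closed_underD[OF A f]) auto
    have "f (map \<phi> xs) \<in> B" using xs by (intro closed_underD[OF B f]) auto
    moreover have "\<phi> (f xs) = f (map \<phi> xs)" using xs by (intro endos_hom[OF \<phi> f]) auto
    ultimately show "f xs \<in> ?P" using A' by simp
  qed
  moreover have "X \<subseteq> ?P" using X im gen_superset[of X F] by auto
  ultimately have "A \<subseteq> ?P" using gen_minimal[of F ?P X] X by simp
  then show ?thesis by blast
qed

section \<open>Composition, the semigroup \<open>T A F B\<close> and its principal left
  ideals\<close>

lemma rcomp_apply: "a \<in> A \<Longrightarrow> rcomp A \<alpha> \<beta> a = \<beta> (\<alpha> a)"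
  by (simp add: rcomp_def compose_def)

lemma rcomp_image: "rcomp A \<alpha> \<beta> ` C = \<beta> ` \<alpha> ` C" if "C \<subseteq> A"
proof -
  have "rcomp A \<alpha> \<beta> ` C = (\<lambda>a. \<beta> (\<alpha> a)) ` C"
    using that by (intro image_cong) (auto simp: rcomp_apply)
  then show ?thesis by (simp add: image_image)
qed

lemma rcomp_assoc:
  assumes "\<alpha> \<in> A \<rightarrow> A"
  shows "rcomp A (rcomp A \<alpha> \<beta>) \<gamma> = rcomp A \<alpha> (rcomp A \<beta> \<gamma>)"
  using compose_assoc[OF assms] by (simp add: rcomp_def)

lemma rcomp_endos:
  assumes A: "closed_under F A" and \<alpha>: "\<alpha> \<in> endos A F" and \<beta>: "\<beta> \<in> endos A F"
  shows "rcomp A \<alpha> \<beta> \<in> endos A F"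
proof -
  have "rcomp A \<alpha> \<beta> \<in> A \<rightarrow>\<^sub>E A"
    using endos_funcset[OF \<alpha>] endos_funcset[OF \<beta>]
    by (auto simp: rcomp_def compose_def)
  moreover have "rcomp A \<alpha> \<beta> (f xs) = f (map (rcomp A \<alpha> \<beta>) xs)"
    if f: "(length xs, f) \<in> F" and xs: "set xs \<subseteq> A" for f xs
  proof -
    have "rcomp A \<alpha> \<beta> (f xs) = \<beta> (\<alpha> (f xs))"
      using closed_underD[OF A f _ xs] by (simp add: rcomp_apply)
    also have "\<dots> = \<beta> (f (map \<alpha> xs))" using endos_hom[OF \<alpha> f xs] by simp
    also have "\<dots> = f (map \<beta> (map \<alpha> xs))"
      using f xs endos_funcset[OF \<alpha>] by (intro endos_hom[OF \<beta>]) auto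
    also have "map \<beta> (map \<alpha> xs) = map (rcomp A \<alpha> \<beta>) xs"
      using xs by (auto simp: rcomp_apply subset_iff)
    finally show ?thesis .
  qed
  ultimately show ?thesis unfolding endos_def by blast
qed

lemma rcomp_T:
  assumes "closed_under F A" "\<alpha> \<in> T A F B" "\<beta> \<in> T A F B"
  shows "rcomp A \<alpha> \<beta> \<in> T A F B"
proof -
  have "\<alpha> ` A \<subseteq> A" "\<beta> ` A \<subseteq> B"
    using assms(2,3) endos_funcset[of \<alpha> A F] by (auto simp: T_def)
  then have "rcomp A \<alpha> \<beta> ` A \<subseteq> B" by (auto simp: rcomp_apply)
  then show ?thesis using assms rcomp_endos[OF assms(1)] by (auto simp: T_def)
qed

text \<open>By associativity a left multiple of \<gamma>\<beta> by s is the left multiple of \<beta>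
  by s\<gamma>, and s\<gamma> stays in \<open>T A F B\<close>.\<close>

lemma principal_left_ideal_rcomp_subset:
  assumes "closed_under F A" "\<gamma> \<in> T A F B"
  shows "principal_left_ideal (T A F B) (rcomp A) (rcomp A \<gamma> \<beta>)
    \<subseteq> principal_left_ideal (T A F B) (rcomp A) \<beta>"
proof -
  have "rcomp A s (rcomp A \<gamma> \<beta>) = rcomp A (rcomp A s \<gamma>) \<beta>" if "s \<in> T A F B" for s
    using that endos_funcset[of s A F] by (subst rcomp_assoc) (auto simp: T_def)
  then show ?thesis
    using assms rcomp_T[OF assms(1) _ assms(2)] by (auto simp: principal_left_ideal_def)
qed

text \<open>If \<alpha> and \<beta> are distinct, neither membership in the other's ideal can come
  from the adjoined identity, so both come from factors in \<open>T A F B\<close>.\<close>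

lemma green_L_T_iff:
  assumes "closed_under F A" "\<alpha> \<in> T A F B" "\<beta> \<in> T A F B"
  shows "green_L (T A F B) (rcomp A) \<alpha> \<beta> \<longleftrightarrow>
    \<alpha> = \<beta> \<or> ((\<exists>\<gamma>\<in>T A F B. \<alpha> = rcomp A \<gamma> \<beta>) \<and> (\<exists>\<delta>\<in>T A F B. \<beta> = rcomp A \<delta> \<alpha>))"
    (is "?L \<longleftrightarrow> ?R")
proof
  assume ?L
  then have "\<alpha> \<in> principal_left_ideal (T A F B) (rcomp A) \<beta>"
    "\<beta> \<in> principal_left_ideal (T A F B) (rcomp A) \<alpha>"
    by (auto simp: green_L_def principal_left_ideal_def)
  then show ?R by (auto simp: principal_left_ideal_def)
next
  assume ?R
  then have "principal_left_ideal (T A F B) (rcomp A) \<alpha> = principal_left_ideal (T A F B) (rcomp A) \<beta>"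
    using principal_left_ideal_rcomp_subset[OF assms(1)] by (metis subset_antisym)
  then show ?L using assms by (simp add: green_L_def)
qed

section \<open>Left factors, images and membership in \<open>Q A F B\<close>\<close>

lemma mutual_left_factors_Q:
  assumes "B \<subseteq> A" "\<alpha> \<in> T A F B" "\<gamma> \<in> T A F B" "\<delta> \<in> T A F B"
    and "\<alpha> = rcomp A \<gamma> \<beta>" "\<beta> = rcomp A \<delta> \<alpha>"
  shows "\<alpha> \<in> Q A F B"
proof -
  \<comment> \<open>\<gamma> squeezes all of \<open>A\<close> into \<open>B\<close>, and \<delta>
    then keeps the computation inside \<open>B\<close>, so the final bound is \<alpha> on
    \<open>B\<close> rather than on \<open>A\<close>.\<close>
  have "\<gamma> ` A \<subseteq> B" "\<delta> ` B \<subseteq> B" using assms(1,3,4) by (auto simp: T_def)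
  have "\<alpha> ` A = \<beta> ` \<gamma> ` A" using assms(5) rcomp_image[of A A \<gamma> \<beta>] by simp
  also have "\<dots> \<subseteq> \<beta> ` B" using \<open>\<gamma> ` A \<subseteq> B\<close> by (rule image_mono)
  also have "\<dots> = \<alpha> ` \<delta> ` B" using assms(6) rcomp_image[OF assms(1), of \<delta> \<alpha>] by simp
  also have "\<dots> \<subseteq> \<alpha> ` B" using \<open>\<delta> ` B \<subseteq> B\<close> by (rule image_mono)
  finally show ?thesis using assms(2) by (simp add: Q_def)
qed

lemma rcomp_T_image_subset: "\<gamma> \<in> T A F B \<Longrightarrow> rcomp A \<gamma> \<beta> ` A \<subseteq> \<beta> ` A"
  using endos_funcset[of \<gamma> A F] by (auto simp: T_def rcomp_apply)

lemma (in independence_algebra) left_factor_if_image_subset: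
  assumes B: "subalgebra A F B" and \<alpha>: "\<alpha> \<in> T A F B" and \<beta>: "\<beta> \<in> Q A F B"
    and im: "\<alpha> ` A \<subseteq> \<beta> ` A"
  shows "\<exists>\<gamma>\<in>T A F B. \<alpha> = rcomp A \<gamma> \<beta>"
proof -
  obtain X where basis: "basis_of F A X" using basis_exists ..
  then have X: "gen F X = A" by (simp add: basis_of_def)
  then have XA: "X \<subseteq> A" using gen_superset[of X F] by simp
  have cB: "B \<subseteq> A" "closed_under F B" using B by (auto simp: subalgebra_def)
  have \<beta>E: "\<beta> \<in> endos A F" and \<alpha>E: "\<alpha> \<in> endos A F" using \<alpha> \<beta> by (auto simp: T_def Q_def)
  \<comment> \<open>Membership of \<beta> in \<open>Q\<close> moves the preimages from
    \<open>A\<close> into \<open>B\<close>, which is what will put \<gamma> in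
    \<open>T A F B\<close>.\<close>
  have "\<alpha> ` A \<subseteq> \<beta> ` B" using im \<beta> by (auto simp: Q_def)
  then have "\<forall>x\<in>X. \<exists>b\<in>B. \<beta> b = \<alpha> x" using XA by (fastforce simp: image_iff)
  then obtain g where g: "\<And>x. x \<in> X \<Longrightarrow> g x \<in> B" "\<And>x. x \<in> X \<Longrightarrow> \<beta> (g x) = \<alpha> x" by metis
  then obtain \<gamma> where \<gamma>: "\<gamma> \<in> endos A F" "\<And>x. x \<in> X \<Longrightarrow> \<gamma> x = g x"
    using free_basis[OF basis, of g] cB by blast
  then have "\<gamma> ` A \<subseteq> B"
    using endos_image_subset[OF \<gamma>(1) closed cB(2) X] g by auto
  then have "\<gamma> \<in> T A F B" using \<gamma> by (simp add: T_def)
  moreover have "\<alpha> = rcomp A \<gamma> \<beta>"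
    using endos_eqI[OF \<alpha>E rcomp_endos[OF closed \<gamma>(1) \<beta>E] closed X] \<gamma>(2) g(2) XA
    by (auto simp: rcomp_apply subset_iff)
  ultimately show ?thesis by blast
qed

theorem proposition4p2:
  fixes A B :: "'a set" and F :: "'a operation set"
  assumes "independence_algebra A F"
    and "subalgebra A F B"
    and "B \<noteq> {}"
    and "B \<noteq> A"
    and "natLeq_on 2 \<le>o dimension F B \<or> (gen F {} \<noteq> {} \<and> dimension F B =o natLeq_on 1)"
  shows "(\<forall>\<alpha>\<in>T A F B. \<forall>\<beta>\<in>Q A F B.
            (\<exists>\<gamma>\<in>T A F B. \<alpha> = rcomp A \<gamma> \<beta>) \<longleftrightarrow> \<alpha> ` A \<subseteq> \<beta> ` A)
       \<and> (\<forall>\<alpha>\<in>T A F B. \<forall>\<beta>\<in>T A F B.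
            green_L (T A F B) (rcomp A) \<alpha> \<beta> \<longleftrightarrow>
              \<alpha> = \<beta> \<or> (\<alpha> ` A = \<beta> ` A \<and> \<alpha> \<in> Q A F B \<and> \<beta> \<in> Q A F B))"
proof -
  interpret independence_algebra A F by fact
  have BA: "B \<subseteq> A" using assms(2) by (simp add: subalgebra_def)
  have left_factor: "(\<exists>\<gamma>\<in>T A F B. \<alpha> = rcomp A \<gamma> \<beta>) \<longleftrightarrow> \<alpha> ` A \<subseteq> \<beta> ` A"
    if "\<alpha> \<in> T A F B" "\<beta> \<in> Q A F B" for \<alpha> \<beta>
    using left_factor_if_image_subset[OF assms(2) that] rcomp_T_image_subset[of _ A F B \<beta>] by blast
  have "((\<exists>\<gamma>\<in>T A F B. \<alpha> = rcomp A \<gamma> \<beta>) \<and> (\<exists>\<delta>\<in>T A F B. \<beta> = rcomp A \<delta> \<alpha>))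
      \<longleftrightarrow> \<alpha> ` A = \<beta> ` A \<and> \<alpha> \<in> Q A F B \<and> \<beta> \<in> Q A F B" (is "?l \<longleftrightarrow> ?r")
    if "\<alpha> \<in> T A F B" "\<beta> \<in> T A F B" for \<alpha> \<beta>
  proof
    assume ?l
    then have "\<alpha> \<in> Q A F B" "\<beta> \<in> Q A F B"
      using mutual_left_factors_Q[OF BA] that by metis+
    \<comment> \<open>\<open>left_factor\<close> asks for a right factor in \<open>Q\<close>; now
      that both maps lie there, it applies in both directions.\<close>
    moreover from this have "\<alpha> ` A \<subseteq> \<beta> ` A" "\<beta> ` A \<subseteq> \<alpha> ` A"
      using \<open>?l\<close> left_factor that by simp_all
    ultimately show ?r by simp
  next
    assume ?r
    then show ?l using left_factor that by simp
  qed
  then show ?thesis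
    using left_factor green_L_T_iff[OF closed] by simp
qed

end
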